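(* Let $m\ge 1$ and $k\ge 2$ be integers, and let $\#(n)$ be the number of different blocks of length $n$ allowed in the shift space $T_{m,k}$. Then the ratio of adjacent terms converges and $$\lim_{n\to\infty}\frac{\#(n)}{\#(n-1)}=\lambda_0,$$ where $\lambda_0$ is the largest real root of the equation $\lambda^{m+1}=\lambda^{m}+(k-1)$.
   Context: For integers $m\ge 1$, $k\ge 2$, the shift space $T_{m,k}$ is the set of all bi-infinite sequences $(x_i)_{i\in\mathbb{Z}}$ over the alphabet $\{0,1,\dots,k-1\}$ in which each symbol other than $0$ appears isolated and is separated by at least $m$ $0$'s from any other occurrence of a nonzero symbol (i.e. any two nonzero entries are separated by at least $m$ zeros). A block of length $n$ is a finite sequence of $n$ consecutive symbols; it is allowed if it occurs in some sequence of the shift space. *)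

theory Defs
  imports "HOL-Analysis.Analysis"
begin

definition shift_T :: "nat \<Rightarrow> nat \<Rightarrow> (int \<Rightarrow> nat) set" where
  "shift_T m k = {x. (\<forall>i. x i < k) \<and>
     (\<forall>i j. i < j \<and> x i \<noteq> 0 \<and> x j \<noteq> 0 \<longrightarrow> m \<le> card {l \<in> {i<..<j}. x l = 0})}"

definition blocks :: "(int \<Rightarrow> 'a) set \<Rightarrow> nat \<Rightarrow> 'a list set" where
  "blocks X n = {map (\<lambda>t. x (i + int t)) [0..<n] | x i. x \<in> X}"

definition num_blocks :: "nat \<Rightarrow> nat \<Rightarrow> nat \<Rightarrow> nat" where
  "num_blocks m k n = card (blocks (shift_T m k) n)"

definition is_root :: "nat \<Rightarrow> nat \<Rightarrow> real \<Rightarrow> bool" where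
  "is_root m k l \<longleftrightarrow> l ^ (m + 1) = l ^ m + (real k - 1)"

definition is_largest_root :: "nat \<Rightarrow> nat \<Rightarrow> real \<Rightarrow> bool" where
  "is_largest_root m k l \<longleftrightarrow> is_root m k l \<and> (\<forall>r. is_root m k r \<longrightarrow> r \<le> l)"

end

(* Allowed blocks are the words whose nonzero positions are more than m apart. Splitting off the
   first letter gives #(n + 1) = #(n) + (k - 1) #(n - m). Dividing by powers of the root lam > 1
   turns this into b(n + 1) = p b(n) + q b(n - m) with p, q > 0 and p + q = 1, so every new term is
   an average of two earlier ones. The range of the tail then contracts geometrically, hence b
   converges; the limit is positive, so the ratios b(n) / b(n - 1) tend to 1. *)
theory Submission
  imports Defs
begin

section \<open>Allowed blocks as words with spaced nonzero letters\<close>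

definition spaced_words :: "nat \<Rightarrow> nat \<Rightarrow> nat \<Rightarrow> nat list set" where
  "spaced_words m k n = {w. length w = n \<and> set w \<subseteq> {..<k} \<and>
     (\<forall>i j. i < j \<and> j < n \<and> w ! i \<noteq> 0 \<and> w ! j \<noteq> 0 \<longrightarrow> i + m < j)}"

text \<open>Counting zeros becomes a distance bound. A gap containing \<open>m\<close> zeros has at
  least \<open>m\<close> positions. Conversely, the distance bound for all pairs forces the
  \<open>m\<close> entries after a nonzero one to vanish, so they supply the zeros.\<close>

lemma shift_T_iff_spaced:
  "x \<in> shift_T m k \<longleftrightarrow>
     (\<forall>i. x i < k) \<and> (\<forall>i j. i < j \<and> x i \<noteq> 0 \<and> x j \<noteq> 0 \<longrightarrow> i + int m < j)"
proof -
  have fwd: "i + int m < j" if "i < j" "m \<le> card {l \<in> {i<..<j}. x l = 0}" for i j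
  proof -
    have "card {l \<in> {i<..<j}. x l = 0} \<le> card {i<..<j}"
      by (rule card_mono) auto
    then show ?thesis using that by simp
  qed
  have bwd: "m \<le> card {l \<in> {i<..<j}. x l = 0}"
    if sp: "\<forall>i j. i < j \<and> x i \<noteq> 0 \<and> x j \<noteq> 0 \<longrightarrow> i + int m < j"
      and ij: "i < j" "x i \<noteq> 0" "x j \<noteq> 0" for i j
  proof -
    have "i + int m < j" using sp ij by blast
    moreover have "x l = 0" if "l \<in> {i<..i + int m}" for l
      using sp[rule_format, of i l] ij that by force
    ultimately have "{i<..i + int m} \<subseteq> {l \<in> {i<..<j}. x l = 0}" by auto
    then have "card {i<..i + int m} \<le> card {l \<in> {i<..<j}. x l = 0}"
      by (intro card_mono) (auto intro: finite_subset[of _ "{i<..<j}"])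
    then show ?thesis by simp
  qed
  show ?thesis
    unfolding shift_T_def using fwd bwd by blast
qed

text \<open>A window of a point inherits the spacing. Conversely, a spaced word padded with zeros on
  both sides is a point, since padding creates no new nonzero entries; \<open>k > 0\<close> makes 0
  a letter.\<close>

lemma blocks_shift_T:
  assumes "k > 0"
  shows "blocks (shift_T m k) n = spaced_words m k n"
proof (intro equalityI subsetI)
  fix w assume "w \<in> blocks (shift_T m k) n"
  then obtain x i where x: "x \<in> shift_T m k" and w: "w = map (\<lambda>t. x (i + int t)) [0..<n]"
    unfolding blocks_def by blast
  have "a + m < b" if "a < b" "b < n" "w ! a \<noteq> 0" "w ! b \<noteq> 0" for a b
  proof -
    have "i + int a + int m < i + int b"
      using x that unfolding shift_T_iff_spaced by (auto simp: w)
    then show ?thesis by linarith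
  qed
  moreover have "set w \<subseteq> {..<k}" using x by (auto simp: w shift_T_iff_spaced)
  ultimately show "w \<in> spaced_words m k n"
    by (auto simp: spaced_words_def w)
next
  fix w assume "w \<in> spaced_words m k n"
  then have len: "length w = n" and sub: "set w \<subseteq> {..<k}"
    and sp: "\<And>i j. i < j \<Longrightarrow> j < n \<Longrightarrow> w ! i \<noteq> 0 \<Longrightarrow> w ! j \<noteq> 0 \<Longrightarrow> i + m < j"
    by (auto simp: spaced_words_def)
  define x where "x i = (if 0 \<le> i \<and> i < int n then w ! nat i else 0)" for i
  have "x i < k" for i
    using assms subsetD[OF sub nth_mem[of "nat i"]] by (simp add: x_def len nat_less_iff)
  moreover have "i + int m < j" if "i < j" "x i \<noteq> 0" "x j \<noteq> 0" for i j
  proof -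
    have *: "0 \<le> i" "j < int n" using that by (auto simp: x_def split: if_splits)
    then have "nat i + m < nat j"
      using that by (intro sp) (auto simp: x_def split: if_splits)
    then show ?thesis using * that(1) by linarith
  qed
  ultimately have "x \<in> shift_T m k" by (auto simp: shift_T_iff_spaced)
  moreover have "w = map (\<lambda>t. x (0 + int t)) [0..<n]"
    by (rule nth_equalityI) (auto simp: len x_def)
  ultimately show "w \<in> blocks (shift_T m k) n"
    unfolding blocks_def by blast
qed

section \<open>Recursion for the number of words\<close>

lemma finite_spaced_words: "finite (spaced_words m k n)"
  by (rule finite_subset[OF _ finite_lists_length_eq[of "{..<k}" n]])
     (auto simp: spaced_words_def)

lemma spaced_words_0 [simp]: "spaced_words m k 0 = {[]}"
  by (auto simp: spaced_words_def)

text \<open>Prepending shifts all positions of \<open>v\<close> equally, so only pairs with the new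
  letter matter. Position \<open>j\<close> of \<open>v\<close> becomes \<open>j + 1\<close>, which
  is too close to 0 exactly when \<open>j < m\<close>.\<close>

lemma Cons_in_spaced_words:
  "a # v \<in> spaced_words m k (Suc n) \<longleftrightarrow>
     a < k \<and> v \<in> spaced_words m k n \<and> (a \<noteq> 0 \<longrightarrow> (\<forall>j < min m n. v ! j = 0))"
  (is "?L \<longleftrightarrow> ?R")
proof
  assume L: ?L
  then have sp: "i < j \<Longrightarrow> j < Suc n \<Longrightarrow> (a # v) ! i \<noteq> 0 \<Longrightarrow> (a # v) ! j \<noteq> 0 \<Longrightarrow> i + m < j" for i j
    by (auto simp: spaced_words_def)
  have "i + m < j" if "i < j" "j < n" "v ! i \<noteq> 0" "v ! j \<noteq> 0" for i j
    using sp[of "Suc i" "Suc j"] that by simp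
  moreover have "v ! j = 0" if "a \<noteq> 0" "j < min m n" for j
    using sp[of 0 "Suc j"] that by auto
  ultimately show ?R using L by (auto simp: spaced_words_def)
next
  assume R: ?R
  have "i + m < j"
    if "i < j" "j < Suc n" "(a # v) ! i \<noteq> 0" "(a # v) ! j \<noteq> 0" for i j
  proof -
    obtain j' where j: "j = Suc j'" using \<open>i < j\<close> by (cases j) auto
    show ?thesis
    proof (cases i)
      case 0
      then have "\<not> j' < min m n" using R that j by auto
      then show ?thesis using 0 j that by auto
    next
      case (Suc i')
      then show ?thesis using R that j by (auto simp: spaced_words_def)
    qed
  qed
  then show ?L using R by (auto simp: spaced_words_def)
qed

lemma replicate_append_in_spaced_words:
  assumes "k > 0"
  shows "replicate r 0 @ u \<in> spaced_words m k (r + l) \<longleftrightarrow> u \<in> spaced_words m k l"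
  using assms by (induction r) (auto simp: Cons_in_spaced_words)

text \<open>The truncated difference \<open>n - m\<close> is intended: if \<open>n < m\<close>, a leading nonzero letter forces
  all remaining letters to vanish, leaving the single empty word.\<close>

lemma spaced_words_Suc:
  assumes "k > 0"
  shows "spaced_words m k (Suc n) = (#) 0 ` spaced_words m k n \<union>
    (\<lambda>(a, u). a # replicate (min m n) 0 @ u) ` ({1..<k} \<times> spaced_words m k (n - m))"
    (is "_ = ?Z \<union> ?N")
proof (intro equalityI subsetI)
  fix w assume w: "w \<in> spaced_words m k (Suc n)"
  then obtain a v where av: "w = a # v" by (cases w) (auto simp: spaced_words_def)
  note wv = w[unfolded av Cons_in_spaced_words]
  show "w \<in> ?Z \<union> ?N"
  proof (cases "a = 0")
    case True
    then show ?thesis using wv av by auto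
  next
    case False
    define u where "u = drop (min m n) v"
    have len: "length v = n" using wv by (auto simp: spaced_words_def)
    have "take (min m n) v = replicate (min m n) 0"
      by (rule nth_equalityI) (use wv False len in auto)
    then have v: "v = replicate (min m n) 0 @ u"
      by (metis append_take_drop_id u_def)
    \<comment> \<open>Even with truncated subtraction, \<open>min m n + (n - m) = n\<close>, so the
      zeros can be stripped.\<close>
    have "u \<in> spaced_words m k (n - m)"
      using wv v replicate_append_in_spaced_words[OF assms, of "min m n" u m "n - m"]
      by (auto simp: min_def split: if_splits)
    then show ?thesis using wv av v False by (auto simp: image_iff)
  qed
next
  fix w assume "w \<in> ?Z \<union> ?N"
  then show "w \<in> spaced_words m k (Suc n)"
  proof
    assume "w \<in> ?Z"
    then show ?thesis using assms by (auto simp: Cons_in_spaced_words)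
  next
    assume "w \<in> ?N"
    then obtain a u where "w = a # replicate (min m n) 0 @ u" "1 \<le> a" "a < k"
      "u \<in> spaced_words m k (n - m)" by auto
    then show ?thesis
      using replicate_append_in_spaced_words[OF assms, of "min m n" u m "n - m"]
      by (auto simp: Cons_in_spaced_words nth_append min_def split: if_splits)
  qed
qed

lemma num_blocks_0:
  assumes "k > 0"
  shows "num_blocks m k 0 = 1"
  using assms by (simp add: num_blocks_def blocks_shift_T)

text \<open>The two families of words differ in whether the first letter is 0, and both prepending
  maps are injective, so the cardinalities add.\<close>

lemma num_blocks_Suc:
  assumes "k > 0"
  shows "num_blocks m k (Suc n) = num_blocks m k n + (k - 1) * num_blocks m k (n - m)"
proof -
  let ?f = "\<lambda>(a, u). a # replicate (min m n) (0::nat) @ u"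
  let ?P = "{1..<k} \<times> spaced_words m k (n - m)"
  have "card (spaced_words m k (Suc n)) = card ((#) 0 ` spaced_words m k n) + card (?f ` ?P)"
    unfolding spaced_words_Suc[OF assms]
    by (rule card_Un_disjoint) (auto simp: finite_spaced_words)
  also have "card ((#) 0 ` spaced_words m k n) = card (spaced_words m k n)"
    by (rule card_image) auto
  also have "card (?f ` ?P) = card ?P"
    by (rule card_image) (auto simp: inj_on_def)
  finally show ?thesis
    using assms by (simp add: num_blocks_def blocks_shift_T card_cartesian_product)
qed

section \<open>Convergence of averaging recurrences\<close>

text \<open>The recurrence is indexed from \<open>n + m\<close> to avoid truncated subtraction. It
  will be applied to the counts divided by powers of the root.\<close>

locale averaging_recurrence =
  fixes b :: "nat \<Rightarrow> real" and p q :: real and m :: nat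
  assumes p: "p > 0" and q: "q > 0" and pq: "p + q = 1"
    and average: "b (Suc (n + m)) = p * b (n + m) + q * b n"
begin

text \<open>By linearity, every lower bound proved below also yields an upper bound.\<close>

lemma average_neg: "averaging_recurrence (\<lambda>n. - b n) p q m"
  by unfold_locales (use p q pq average in auto)

text \<open>Any \<open>m + 1\<close> consecutive terms determine all later ones, and each later term
  is a convex combination of two earlier terms that are at least \<open>x\<close>.\<close>

lemma lower_bound_from_window:
  assumes "\<And>i. n \<le> i \<Longrightarrow> i \<le> n + m \<Longrightarrow> x \<le> b i" and "n \<le> i"
  shows "x \<le> b i"
  using \<open>n \<le> i\<close>
proof (induction i rule: less_induct)
  case (less i)
  show ?case
  proof (cases "i \<le> n + m")
    case False
    define j where "j = i - Suc m"
    have i: "i = Suc (j + m)" "n \<le> j" using False by (auto simp: j_def)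
    have "x = p * x + q * x" using pq by (metis distrib_right mult_1)
    also have "\<dots> \<le> p * b (j + m) + q * b j"
      using p q i less.IH by (intro add_mono mult_left_mono) auto
    finally show ?thesis using i average by simp
  qed (use assms less.prems in auto)
qed

text \<open>The excess of \<open>b (n + m)\<close> over \<open>x\<close> shrinks at most by the
  factor \<open>p\<close> per step, because the other averaged term is at least \<open>x\<close>. A
  share \<open>p ^ m\<close> thus survives on a full window of \<open>m + 1\<close> terms, and hence
  forever.\<close>

lemma raised_lower_bound:
  assumes low: "\<And>i. n \<le> i \<Longrightarrow> x \<le> b i" and "n + m \<le> i"
  shows "x + p ^ m * (b (n + m) - x) \<le> b i"
proof -
  have step: "x + p ^ j * (b (n + m) - x) \<le> b (n + m + j)" for j
  proof (induction j)
    case (Suc j)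
    have "x + p ^ Suc j * (b (n + m) - x) = p * (x + p ^ j * (b (n + m) - x)) + (1 - p) * x"
      by (simp add: algebra_simps)
    also have "\<dots> = p * (x + p ^ j * (b (n + m) - x)) + q * x"
      using pq by (simp add: algebra_simps flip: pq)
    also have "\<dots> \<le> p * b (n + m + j) + q * b (n + j)"
      using p q Suc low by (intro add_mono mult_left_mono) auto
    also have "\<dots> = b (n + m + Suc j)"
      using average[of "n + j"] by (simp add: ac_simps)
    finally show ?case .
  qed simp
  show ?thesis
  proof (rule lower_bound_from_window[OF _ \<open>n + m \<le> i\<close>])
    fix i assume i: "n + m \<le> i" "i \<le> n + m + m"
    define j where "j = i - (n + m)"
    have "j \<le> m" and ij: "i = n + m + j" using i by (auto simp: j_def)
    then have "p ^ m \<le> p ^ j" using p q pq by (intro power_decreasing) auto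
    then have "x + p ^ m * (b (n + m) - x) \<le> x + p ^ j * (b (n + m) - x)"
      using low by (intro add_left_mono mult_right_mono) auto
    with step[of j] ij show "x + p ^ m * (b (n + m) - x) \<le> b i" by simp
  qed
qed

text \<open>If \<open>b (n + m)\<close> lies in the upper half of the range, the lower bound rises
  by \<open>p ^ m * (y - x) / 2\<close>; otherwise the same argument for \<open>- b\<close> brings
  the upper bound down by that amount.\<close>

lemma range_contraction:
  assumes bnd: "\<And>i. n \<le> i \<Longrightarrow> x \<le> b i \<and> b i \<le> y"
  shows "\<exists>x' y'. y' - x' = (1 - p ^ m / 2) * (y - x) \<and> (\<forall>i \<ge> n + m. x' \<le> b i \<and> b i \<le> y')"
proof (cases "b (n + m) \<ge> (x + y) / 2")
  case True
  have "x + p ^ m * ((y - x) / 2) \<le> b i" if "i \<ge> n + m" for i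
  proof -
    have "x + p ^ m * ((y - x) / 2) \<le> x + p ^ m * (b (n + m) - x)"
      using True p by (intro add_left_mono mult_left_mono) (auto simp: field_simps)
    also have "\<dots> \<le> b i" using raised_lower_bound[of n x i] bnd that by simp
    finally show ?thesis .
  qed
  then show ?thesis using bnd
    by (intro exI[of _ "x + p ^ m * ((y - x) / 2)"] exI[of _ y]) (auto simp: field_simps)
next
  case False
  interpret neg: averaging_recurrence "\<lambda>n. - b n" p q m by (rule average_neg)
  have "b i \<le> y - p ^ m * ((y - x) / 2)" if "i \<ge> n + m" for i
  proof -
    have "- y + p ^ m * ((y - x) / 2) \<le> - y + p ^ m * (- b (n + m) - - y)"
      using False p by (intro add_left_mono mult_left_mono) (auto simp: field_simps)
    also have "\<dots> \<le> - b i" using neg.raised_lower_bound[of n "- y" i] bnd that by simp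
    finally show ?thesis by simp
  qed
  then show ?thesis using bnd
    by (intro exI[of _ x] exI[of _ "y - p ^ m * ((y - x) / 2)"]) (auto simp: field_simps)
qed

lemma convergent_averaging: "convergent b"
proof -
  interpret neg: averaging_recurrence "\<lambda>n. - b n" p q m by (rule average_neg)
  \<comment> \<open>The extremes of the first window bound the whole sequence.\<close>
  define x0 y0 where "x0 = Min (b ` {..m})" and "y0 = Max (b ` {..m})"
  define r where "r = 1 - p ^ m / 2"
  have r: "\<bar>r\<bar> < 1"
  proof -
    have "p ^ m \<le> 1" using p q pq by (intro power_le_one) auto
    moreover have "p ^ m > 0" using p by simp
    ultimately show ?thesis by (simp add: r_def)
  qed
  have lo: "x0 \<le> b i" for i
    by (rule lower_bound_from_window[of 0]) (auto simp: x0_def)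
  have "- y0 \<le> - b i" for i
    by (rule neg.lower_bound_from_window[of 0]) (auto simp: y0_def)
  with lo have bounds: "x0 \<le> b i \<and> b i \<le> y0" for i by simp
  have tail: "\<exists>n x y. y - x = r ^ j * (y0 - x0) \<and> (\<forall>i \<ge> n. x \<le> b i \<and> b i \<le> y)" for j
  proof (induction j)
    case 0
    show ?case using bounds by auto
  next
    case (Suc j)
    then obtain n x y where *: "y - x = r ^ j * (y0 - x0)" "\<forall>i \<ge> n. x \<le> b i \<and> b i \<le> y"
      by blast
    then obtain x' y' where "y' - x' = r * (y - x)" "\<forall>i \<ge> n + m. x' \<le> b i \<and> b i \<le> y'"
      using range_contraction[of n x y] unfolding r_def by blast
    with * show ?case by (metis mult.assoc power_Suc)
  qed
  have "Cauchy b"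
  proof (rule metric_CauchyI)
    fix e :: real assume "e > 0"
    have "(\<lambda>j. r ^ j * (y0 - x0)) \<longlonglongrightarrow> 0"
      using r by (intro tendsto_mult_left_zero LIMSEQ_abs_realpow_zero2) auto
    then have "\<forall>\<^sub>F j in sequentially. r ^ j * (y0 - x0) < e"
      using \<open>e > 0\<close> by (rule order_tendstoD)
    then obtain j where j: "r ^ j * (y0 - x0) < e"
      using eventually_happens by force
    obtain n x y where "y - x = r ^ j * (y0 - x0)" "\<forall>i \<ge> n. x \<le> b i \<and> b i \<le> y"
      using tail by blast
    with j have "dist (b i) (b i') < e" if "i \<ge> n" "i' \<ge> n" for i i'
      using that unfolding dist_real_def by (smt (verit))
    then show "\<exists>M. \<forall>i\<ge>M. \<forall>i'\<ge>M. dist (b i) (b i') < e" by blast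
  qed
  then show ?thesis by (simp add: Cauchy_convergent_iff)
qed

text \<open>The limit must be nonzero: the minimum of the first \<open>m + 1\<close> terms is
  positive and bounds all terms from below.\<close>

lemma ratio_tendsto_1:
  assumes "\<And>i. b i > 0"
  shows "(\<lambda>n. b (Suc n) / b n) \<longlonglongrightarrow> 1"
proof -
  obtain L where L: "b \<longlonglongrightarrow> L" using convergent_averaging by (auto simp: convergent_def)
  define x where "x = Min (b ` {..m})"
  have "x \<le> b i" for i
    by (rule lower_bound_from_window[of 0]) (auto simp: x_def)
  then have "x \<le> L" using L by (intro LIMSEQ_le_const) auto
  moreover have "x > 0" using assms by (simp add: x_def)
  ultimately have "L \<noteq> 0" by simp
  then have "(\<lambda>n. b (Suc n) / b n) \<longlonglongrightarrow> L / L"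
    using L by (intro tendsto_divide LIMSEQ_Suc)
  then show ?thesis using \<open>L \<noteq> 0\<close> by simp
qed

end

section \<open>The largest root and the limit of the ratios\<close>

text \<open>With \<open>f x = x ^ m * (x - 1)\<close>, the equation reads
  \<open>f x = k - 1\<close>. A root exists between 1 and \<open>k\<close> by the intermediate value
  theorem, and it differs from 1 because \<open>f 1 = 0\<close>. Beyond it \<open>f\<close> is
  strictly larger, as both factors grow.\<close>

lemma ex_largest_root:
  assumes "k \<ge> 2"
  shows "\<exists>l > 1. is_largest_root m k l"
proof -
  define f :: "real \<Rightarrow> real" where "f x = x ^ m * (x - 1)" for x
  have root_iff: "is_root m k x \<longleftrightarrow> f x = real k - 1" for x
    by (auto simp: is_root_def f_def algebra_simps)
  have "1 * (real k - 1) \<le> f (real k)"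
    unfolding f_def using assms by (intro mult_right_mono one_le_power) auto
  moreover have "f 1 \<le> real k - 1" using assms by (simp add: f_def)
  moreover have "continuous_on {1..real k} f"
    unfolding f_def by (intro continuous_intros)
  ultimately obtain l where l: "1 \<le> l" "f l = real k - 1"
    using IVT'[of f 1 "real k - 1" "real k"] assms by auto
  have "l \<noteq> 1" using l assms by (auto simp: f_def)
  with l have "l > 1" by simp
  have "r \<le> l" if "f r = real k - 1" for r
  proof (rule ccontr)
    assume "\<not> r \<le> l"
    then have "l ^ m * (l - 1) < r ^ m * (r - 1)"
      using \<open>l > 1\<close> by (intro mult_le_less_imp_less power_mono) auto
    then show False using that l by (simp add: f_def)
  qed
  with l \<open>l > 1\<close> show ?thesis
    by (auto simp: is_largest_root_def root_iff)
qed

theorem mainTheorem5: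
  fixes m k :: nat
  assumes "m \<ge> 1" and "k \<ge> 2"
  shows "\<exists>lam0::real. is_largest_root m k lam0 \<and>
    (\<lambda>n. real (num_blocks m k n) / real (num_blocks m k (n - 1))) \<longlonglongrightarrow> lam0"
proof -
  obtain l where l: "l > 1" and largest: "is_largest_root m k l"
    using ex_largest_root[OF assms(2)] by blast
  define N where "N n = real (num_blocks m k n)" for n
  define b where "b n = N n / l ^ n" for n
  have k: "k > 0" using assms(2) by simp
  have N_Suc: "N (Suc n) = N n + (real k - 1) * N (n - m)" for n
    using k by (simp add: N_def num_blocks_Suc of_nat_diff)
  have N_pos: "N n > 0" for n
    by (induction n) (use k in \<open>simp_all add: N_def num_blocks_0 num_blocks_Suc del: of_nat_add\<close>)
  have b_pos: "b n > 0" for n using N_pos l by (simp add: b_def)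
  have root: "l ^ Suc m = l ^ m + (real k - 1)"
    using largest by (simp add: is_largest_root_def is_root_def)
  interpret averaging_recurrence b "1 / l" "(real k - 1) / l ^ Suc m" m
  proof
    show "1 / l + (real k - 1) / l ^ Suc m = 1"
    proof -
      \<comment> \<open>The weights sum to 1 because this is the root equation divided by
        \<open>l ^ Suc m\<close>.\<close>
      have "1 / l = l ^ m / l ^ Suc m" using l by simp
      then have "1 / l + (real k - 1) / l ^ Suc m = (l ^ m + (real k - 1)) / l ^ Suc m"
        by (simp only: add_divide_distrib)
      also have "\<dots> = 1" using l by (simp flip: root)
      finally show ?thesis .
    qed
    \<comment> \<open>At index \<open>n + m\<close> the truncated difference
      \<open>n + m - m\<close> is exactly \<open>n\<close>.\<close>
    show "b (Suc (n + m)) = 1 / l * b (n + m) + (real k - 1) / l ^ Suc m * b n" for n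
      using l by (simp add: b_def N_Suc add_divide_distrib power_add mult_ac)
  qed (use l assms(2) in auto)
  have "(\<lambda>n. l * (b (Suc n) / b n)) \<longlonglongrightarrow> l * 1"
    using ratio_tendsto_1[OF b_pos] by (intro tendsto_mult tendsto_const)
  moreover have "l * (b (Suc n) / b n) = N (Suc n) / N n" for n
    using l by (simp add: b_def)
  \<comment> \<open>Writing \<open>Suc n - 1\<close> for \<open>n\<close> prepares the index shift,
    which discards only the term at 0, where \<open>n - 1\<close> is truncated.\<close>
  ultimately have "(\<lambda>n. N (Suc n) / N (Suc n - 1)) \<longlonglongrightarrow> l" by simp
  then have "(\<lambda>n. N n / N (n - 1)) \<longlonglongrightarrow> l" by (rule LIMSEQ_imp_Suc)
  then show ?thesis using largest unfolding N_def by blast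
qed

end
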